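(* For a formula $\phi$, a variable $x$ and a variable $a$, the formula $a\in\{x\mid\phi\}\Rightarrow\exists x\,\phi$ is derivable.
   Context: Formal system. Objects are generated from the constant $\varnothing$ by: $(\alpha)^{\mathsf c}$, $(\alpha)^{\mathsf v}$ (variables are objects of this form), $(\alpha\,\&\,\beta)$ (federation), $(\alpha\Rightarrow\beta)$ (containment/implication), $(\alpha\cap\beta)$, and classes $\{x\mid\beta\}$ ($x$ a variable, which becomes a bound index). $\alpha[x:=\beta]$ replaces every free appearance of $x$ by $\beta$. A formula is an object of the form $\alpha\Rightarrow\beta$. Abbreviations: $\bot:=\varnothing^{\mathsf c}$; $\neg a:=(a\Rightarrow\bot)$; $\bar a:=(\varnothing\Rightarrow a)$; $a\vee b:=\overline{\bar a\cap\bar b}$; $a=b:=(a\Rightarrow b)\&(b\Rightarrow a)$; $a\neq b:=\neg(a=b)$; $\mathrm{Sing}(a):=(\bar a\neq a)\,\&\,((a\Rightarrow b)\Rightarrow(\bar b\vee a=b))$, with $b$ a variable; $a\in b:=\mathrm{Sing}(a)\&(b\Rightarrow a)$; $V:=\{x\mid\varnothing\}$; $\forall x\,\phi:=(V=\{x\mid\phi\})$; $\exists x\,\phi:=(\varnothing\neq\{x\mid\phi\})$. Rules: R1 from $\alpha$ and $\alpha\Rightarrow\beta$ infer $\beta$; R2 from $\alpha$ infer $\alpha[x:=\beta]$; R3 if $x$ does not appear in $\gamma$, from $\gamma\Rightarrow(\alpha\Rightarrow\beta)$ infer $\gamma\Rightarrow(\{x\mid\beta\}\Rightarrow\{x\mid\alpha\})$.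 Axioms ($a,b,c,d,x$ variables): A1 $((c\Rightarrow a)\&(c\Rightarrow(a\Rightarrow b)))\Rightarrow(c\Rightarrow b)$; A2 $((d\Rightarrow(a\Rightarrow b))\&(d\Rightarrow(b\Rightarrow c)))\Rightarrow(d\Rightarrow(a\Rightarrow c))$; A3 $((c\Rightarrow a)\&(c\Rightarrow b))\Rightarrow(c\Rightarrow(a\&b))$; A4 $(a\&b)\Rightarrow a$, $(a\&b)\Rightarrow b$; A5 $a\Rightarrow(a\cap b)$, $b\Rightarrow(a\cap b)$; A6 $((a\Rightarrow c)\&(b\Rightarrow c))\Rightarrow((a\cap b)\Rightarrow c)$; A7 $a\Rightarrow a$; A8 $a\Rightarrow\varnothing$; A9 $\bot\Rightarrow a$; A10 $(\varnothing\Rightarrow a)\Rightarrow((\varnothing\Rightarrow b)\Rightarrow(a\&b))$; A11 $(a\Rightarrow b)\Rightarrow(\varnothing\Rightarrow(a\Rightarrow b))$; A12 $(((a\Rightarrow b)\Rightarrow\bot)\Rightarrow\bot)\Rightarrow(a\Rightarrow b)$; A13 (schema) $a\in\{x\mid\alpha\}=(\mathrm{Sing}(a)\&\alpha[x:=a])$; A14a $a\Rightarrow\{x\mid x\in a\}$; A14b $(V\Rightarrow a)\Rightarrow(\{x\mid x\in a\}\Rightarrow a)$. *)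

theory Defs imports Main begin

text \<open>
  Syntax in locally nameless style: free variables are named, while a variable bound by a class
  has become a (de Bruijn) index, so a class does not depend on the choice of its bound variable.
  \<open>(\<alpha>)\<^sup>c\<close> is \<open>Con \<alpha>\<close>, \<open>(\<alpha>)\<^sup>v\<close> is \<open>Var \<alpha>\<close>. The argument of \<open>Con\<close> and \<open>Var\<close> is an inert label: a
  variable \<open>x\<close> does not count as appearing in \<open>Con x\<close> or in the different variable \<open>Var x\<close>.
\<close>

datatype tm =
    Emp  ("\<^bold>\<emptyset>")
  | Con tm
  | Var tm
  | Idx nat
  | Fed tm tm  (infixr "\<^bold>&" 65)
  | Imp tm tm  (infixr "\<^bold>\<Rightarrow>" 55)
  | Cap tm tm  (infixr "\<^bold>\<inter>" 70)
  | Bind tm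

primrec bind_var :: "tm \<Rightarrow> nat \<Rightarrow> tm \<Rightarrow> tm" where
  "bind_var x k \<^bold>\<emptyset> = \<^bold>\<emptyset>"
| "bind_var x k (Con \<alpha>) = Con \<alpha>"
| "bind_var x k (Var \<alpha>) = (if Var \<alpha> = x then Idx k else Var \<alpha>)"
| "bind_var x k (Idx i) = Idx i"
| "bind_var x k (\<alpha> \<^bold>& \<beta>) = bind_var x k \<alpha> \<^bold>& bind_var x k \<beta>"
| "bind_var x k (\<alpha> \<^bold>\<Rightarrow> \<beta>) = (bind_var x k \<alpha> \<^bold>\<Rightarrow> bind_var x k \<beta>)"
| "bind_var x k (\<alpha> \<^bold>\<inter> \<beta>) = bind_var x k \<alpha> \<^bold>\<inter> bind_var x k \<beta>"
| "bind_var x k (Bind \<alpha>) = Bind (bind_var x (Suc k) \<alpha>)"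

definition Cls :: "tm \<Rightarrow> tm \<Rightarrow> tm"  ("(1\<^bold>{_ \<^bold>| _\<^bold>})") where
  "\<^bold>{x \<^bold>| \<beta>\<^bold>} = Bind (bind_var x 0 \<beta>)"

text \<open>The elements of \<open>tm\<close> that are objects; these have no dangling indices.\<close>

inductive object :: "tm \<Rightarrow> bool" where
  "object \<^bold>\<emptyset>"
| "object \<alpha> \<Longrightarrow> object (Con \<alpha>)"
| "object \<alpha> \<Longrightarrow> object (Var \<alpha>)"
| "object \<alpha> \<Longrightarrow> object \<beta> \<Longrightarrow> object (\<alpha> \<^bold>& \<beta>)"
| "object \<alpha> \<Longrightarrow> object \<beta> \<Longrightarrow> object (\<alpha> \<^bold>\<Rightarrow> \<beta>)"
| "object \<alpha> \<Longrightarrow> object \<beta> \<Longrightarrow> object (\<alpha> \<^bold>\<inter> \<beta>)"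
| "object \<alpha> \<Longrightarrow> object \<beta> \<Longrightarrow> object \<^bold>{Var \<alpha> \<^bold>| \<beta>\<^bold>}"

definition variable :: "tm \<Rightarrow> bool" where
  "variable x \<longleftrightarrow> (\<exists>\<alpha>. object \<alpha> \<and> x = Var \<alpha>)"

definition formula :: "tm \<Rightarrow> bool" where
  "formula \<phi> \<longleftrightarrow> (\<exists>\<alpha> \<beta>. object \<alpha> \<and> object \<beta> \<and> \<phi> = (\<alpha> \<^bold>\<Rightarrow> \<beta>))"

text \<open>
  \<open>\<alpha>[x := \<beta>]\<close>. Since bound appearances are indices, every \<open>x\<close> met is free, and an object
  \<open>\<beta>\<close> cannot be captured.
\<close>

primrec subst :: "tm \<Rightarrow> tm \<Rightarrow> tm \<Rightarrow> tm"  ("_\<^bold>[_ \<^bold>:= _\<^bold>]" [1000, 0, 0] 1000) where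
  "\<^bold>\<emptyset>\<^bold>[x \<^bold>:= \<gamma>\<^bold>] = \<^bold>\<emptyset>"
| "(Con \<alpha>)\<^bold>[x \<^bold>:= \<gamma>\<^bold>] = Con \<alpha>"
| "(Var \<alpha>)\<^bold>[x \<^bold>:= \<gamma>\<^bold>] = (if Var \<alpha> = x then \<gamma> else Var \<alpha>)"
| "(Idx i)\<^bold>[x \<^bold>:= \<gamma>\<^bold>] = Idx i"
| "(\<alpha> \<^bold>& \<beta>)\<^bold>[x \<^bold>:= \<gamma>\<^bold>] = \<alpha>\<^bold>[x \<^bold>:= \<gamma>\<^bold>] \<^bold>& \<beta>\<^bold>[x \<^bold>:= \<gamma>\<^bold>]"
| "(\<alpha> \<^bold>\<Rightarrow> \<beta>)\<^bold>[x \<^bold>:= \<gamma>\<^bold>] = (\<alpha>\<^bold>[x \<^bold>:= \<gamma>\<^bold>] \<^bold>\<Rightarrow> \<beta>\<^bold>[x \<^bold>:= \<gamma>\<^bold>])"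
| "(\<alpha> \<^bold>\<inter> \<beta>)\<^bold>[x \<^bold>:= \<gamma>\<^bold>] = \<alpha>\<^bold>[x \<^bold>:= \<gamma>\<^bold>] \<^bold>\<inter> \<beta>\<^bold>[x \<^bold>:= \<gamma>\<^bold>]"
| "(Bind \<alpha>)\<^bold>[x \<^bold>:= \<gamma>\<^bold>] = Bind (\<alpha>\<^bold>[x \<^bold>:= \<gamma>\<^bold>])"

primrec appears :: "tm \<Rightarrow> tm \<Rightarrow> bool" where
  "appears x \<^bold>\<emptyset> \<longleftrightarrow> False"
| "appears x (Con \<alpha>) \<longleftrightarrow> False"
| "appears x (Var \<alpha>) \<longleftrightarrow> Var \<alpha> = x"
| "appears x (Idx i) \<longleftrightarrow> False"
| "appears x (\<alpha> \<^bold>& \<beta>) \<longleftrightarrow> appears x \<alpha> \<or> appears x \<beta>"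
| "appears x (\<alpha> \<^bold>\<Rightarrow> \<beta>) \<longleftrightarrow> appears x \<alpha> \<or> appears x \<beta>"
| "appears x (\<alpha> \<^bold>\<inter> \<beta>) \<longleftrightarrow> appears x \<alpha> \<or> appears x \<beta>"
| "appears x (Bind \<alpha>) \<longleftrightarrow> appears x \<alpha>"

definition Bot :: tm  ("\<^bold>\<bottom>") where
  "\<^bold>\<bottom> = Con \<^bold>\<emptyset>"

definition Neg :: "tm \<Rightarrow> tm"  ("\<^bold>\<not> _" [90] 90) where
  "\<^bold>\<not> \<alpha> = (\<alpha> \<^bold>\<Rightarrow> \<^bold>\<bottom>)"

definition Bar :: "tm \<Rightarrow> tm" where
  "Bar \<alpha> = (\<^bold>\<emptyset> \<^bold>\<Rightarrow> \<alpha>)"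

definition Or :: "tm \<Rightarrow> tm \<Rightarrow> tm"  (infixr "\<^bold>\<or>" 60) where
  "\<alpha> \<^bold>\<or> \<beta> = Bar (Bar \<alpha> \<^bold>\<inter> Bar \<beta>)"

definition Eq :: "tm \<Rightarrow> tm \<Rightarrow> tm"  (infix "\<^bold>=" 75) where
  "\<alpha> \<^bold>= \<beta> = (\<alpha> \<^bold>\<Rightarrow> \<beta>) \<^bold>& (\<beta> \<^bold>\<Rightarrow> \<alpha>)"

definition Neq :: "tm \<Rightarrow> tm \<Rightarrow> tm"  (infix "\<^bold>\<noteq>" 75) where
  "\<alpha> \<^bold>\<noteq> \<beta> = \<^bold>\<not> (\<alpha> \<^bold>= \<beta>)"

text \<open>
  The formula \<open>Sing(a)\<close> contains an auxiliary free variable \<open>b\<close>, distinct from \<open>a\<close>. It is made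
  an explicit parameter here and hence in \<open>a \<in> \<beta>\<close> (written \<open>a \<in>[b] \<beta>\<close>).
\<close>

definition Sing :: "tm \<Rightarrow> tm \<Rightarrow> tm" where
  "Sing b \<alpha> = (Bar \<alpha> \<^bold>\<noteq> \<alpha>) \<^bold>& ((\<alpha> \<^bold>\<Rightarrow> b) \<^bold>\<Rightarrow> (Bar b \<^bold>\<or> (\<alpha> \<^bold>= b)))"

definition Mem :: "tm \<Rightarrow> tm \<Rightarrow> tm \<Rightarrow> tm"  ("_ \<^bold>\<in>\<^bold>[_\<^bold>] _" [76, 0, 76] 75) where
  "\<alpha> \<^bold>\<in>\<^bold>[b\<^bold>] \<beta> = Sing b \<alpha> \<^bold>& (\<beta> \<^bold>\<Rightarrow> \<alpha>)"

text \<open>The choice of bound variable is immaterial: the class is \<open>Bind Emp\<close> for every choice.\<close>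

definition Univ :: tm  ("\<^bold>V") where
  "\<^bold>V = \<^bold>{Var \<^bold>\<emptyset> \<^bold>| \<^bold>\<emptyset>\<^bold>}"

definition Forall :: "tm \<Rightarrow> tm \<Rightarrow> tm"  ("\<^bold>\<forall>_\<^bold>. _" [100, 80] 80) where
  "\<^bold>\<forall>x\<^bold>. \<phi> = (\<^bold>V \<^bold>= \<^bold>{x \<^bold>| \<phi>\<^bold>})"

definition Exists :: "tm \<Rightarrow> tm \<Rightarrow> tm"  ("\<^bold>\<exists>_\<^bold>. _" [100, 80] 80) where
  "\<^bold>\<exists>x\<^bold>. \<phi> = (\<^bold>\<emptyset> \<^bold>\<noteq> \<^bold>{x \<^bold>| \<phi>\<^bold>})"

definition vars :: "tm list \<Rightarrow> bool" where
  "vars xs \<longleftrightarrow> distinct xs \<and> (\<forall>x \<in> set xs. variable x)"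

text \<open>The axioms are stated for any choice of distinct variables \<open>a, b, c, d, x\<close>.\<close>

inductive derivable :: "tm \<Rightarrow> bool"  ("\<^bold>\<turnstile> _" [50] 50) where
  R1: "\<^bold>\<turnstile> \<alpha> \<Longrightarrow> \<^bold>\<turnstile> \<alpha> \<^bold>\<Rightarrow> \<beta> \<Longrightarrow> \<^bold>\<turnstile> \<beta>"
| R2: "\<^bold>\<turnstile> \<alpha> \<Longrightarrow> variable x \<Longrightarrow> object \<beta> \<Longrightarrow> \<^bold>\<turnstile> \<alpha>\<^bold>[x \<^bold>:= \<beta>\<^bold>]"
| R3: "\<^bold>\<turnstile> \<gamma> \<^bold>\<Rightarrow> (\<alpha> \<^bold>\<Rightarrow> \<beta>) \<Longrightarrow> variable x \<Longrightarrow> \<not> appears x \<gamma>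
       \<Longrightarrow> \<^bold>\<turnstile> \<gamma> \<^bold>\<Rightarrow> (\<^bold>{x \<^bold>| \<beta>\<^bold>} \<^bold>\<Rightarrow> \<^bold>{x \<^bold>| \<alpha>\<^bold>})"
| A1: "vars [a, b, c] \<Longrightarrow> \<^bold>\<turnstile> ((c \<^bold>\<Rightarrow> a) \<^bold>& (c \<^bold>\<Rightarrow> (a \<^bold>\<Rightarrow> b))) \<^bold>\<Rightarrow> (c \<^bold>\<Rightarrow> b)"
| A2: "vars [a, b, c, d] \<Longrightarrow>
       \<^bold>\<turnstile> ((d \<^bold>\<Rightarrow> (a \<^bold>\<Rightarrow> b)) \<^bold>& (d \<^bold>\<Rightarrow> (b \<^bold>\<Rightarrow> c))) \<^bold>\<Rightarrow> (d \<^bold>\<Rightarrow> (a \<^bold>\<Rightarrow> c))"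
| A3: "vars [a, b, c] \<Longrightarrow> \<^bold>\<turnstile> ((c \<^bold>\<Rightarrow> a) \<^bold>& (c \<^bold>\<Rightarrow> b)) \<^bold>\<Rightarrow> (c \<^bold>\<Rightarrow> (a \<^bold>& b))"
| A4a: "vars [a, b] \<Longrightarrow> \<^bold>\<turnstile> (a \<^bold>& b) \<^bold>\<Rightarrow> a"
| A4b: "vars [a, b] \<Longrightarrow> \<^bold>\<turnstile> (a \<^bold>& b) \<^bold>\<Rightarrow> b"
| A5a: "vars [a, b] \<Longrightarrow> \<^bold>\<turnstile> a \<^bold>\<Rightarrow> (a \<^bold>\<inter> b)"
| A5b: "vars [a, b] \<Longrightarrow> \<^bold>\<turnstile> b \<^bold>\<Rightarrow> (a \<^bold>\<inter> b)"
| A6: "vars [a, b, c] \<Longrightarrow> \<^bold>\<turnstile> ((a \<^bold>\<Rightarrow> c) \<^bold>& (b \<^bold>\<Rightarrow> c)) \<^bold>\<Rightarrow> ((a \<^bold>\<inter> b) \<^bold>\<Rightarrow> c)"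
| A7: "vars [a] \<Longrightarrow> \<^bold>\<turnstile> a \<^bold>\<Rightarrow> a"
| A8: "vars [a] \<Longrightarrow> \<^bold>\<turnstile> a \<^bold>\<Rightarrow> \<^bold>\<emptyset>"
| A9: "vars [a] \<Longrightarrow> \<^bold>\<turnstile> \<^bold>\<bottom> \<^bold>\<Rightarrow> a"
| A10: "vars [a, b] \<Longrightarrow> \<^bold>\<turnstile> (\<^bold>\<emptyset> \<^bold>\<Rightarrow> a) \<^bold>\<Rightarrow> ((\<^bold>\<emptyset> \<^bold>\<Rightarrow> b) \<^bold>\<Rightarrow> (a \<^bold>& b))"
| A11: "vars [a, b] \<Longrightarrow> \<^bold>\<turnstile> (a \<^bold>\<Rightarrow> b) \<^bold>\<Rightarrow> (\<^bold>\<emptyset> \<^bold>\<Rightarrow> (a \<^bold>\<Rightarrow> b))"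
| A12: "vars [a, b] \<Longrightarrow> \<^bold>\<turnstile> (((a \<^bold>\<Rightarrow> b) \<^bold>\<Rightarrow> \<^bold>\<bottom>) \<^bold>\<Rightarrow> \<^bold>\<bottom>) \<^bold>\<Rightarrow> (a \<^bold>\<Rightarrow> b)"
| A13: "vars [a, b, x] \<Longrightarrow> object \<alpha> \<Longrightarrow>
        \<^bold>\<turnstile> (a \<^bold>\<in>\<^bold>[b\<^bold>] \<^bold>{x \<^bold>| \<alpha>\<^bold>}) \<^bold>= (Sing b a \<^bold>& \<alpha>\<^bold>[x \<^bold>:= a\<^bold>])"
| A14a: "vars [a, b, x] \<Longrightarrow> \<^bold>\<turnstile> a \<^bold>\<Rightarrow> \<^bold>{x \<^bold>| x \<^bold>\<in>\<^bold>[b\<^bold>] a\<^bold>}"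
| A14b: "vars [a, b, x] \<Longrightarrow> \<^bold>\<turnstile> (\<^bold>V \<^bold>\<Rightarrow> a) \<^bold>\<Rightarrow> (\<^bold>{x \<^bold>| x \<^bold>\<in>\<^bold>[b\<^bold>] a\<^bold>} \<^bold>\<Rightarrow> a)"

end

theory Submission imports Defs begin

text \<open>
  Suppose \<open>a \<in> C\<close> and \<open>\<emptyset> = C\<close>, where \<open>C = {x | \<phi>}\<close>. From \<open>\<emptyset> \<Rightarrow> C\<close> and \<open>C \<Rightarrow> a\<close> we get \<open>\<emptyset> \<Rightarrow> a\<close>.
  Hence \<open>a\<close> and \<open>\<emptyset> \<Rightarrow> a\<close> both contain and are contained in \<open>\<emptyset>\<close>, so \<open>\<emptyset> \<Rightarrow> a\<close> equals \<open>a\<close>, which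
  \<open>Sing a\<close> refutes. The hypothesis \<open>\<emptyset> = C\<close> can be discharged because \<open>a \<in> C\<close> is a federation of
  formulas: by A11 such an object \<open>\<alpha>\<close> satisfies \<open>\<alpha> \<Rightarrow> (\<emptyset> \<Rightarrow> \<alpha>)\<close>.
\<close>

section \<open>Fresh variables\<close>

lemma finite_appears: "finite {x. appears x t}"
  by (induction t) auto

lemma variable_object: "variable x \<Longrightarrow> object x"
  by (auto simp: variable_def intro: object.intros)

text \<open>Any object may label a variable, so the iterates of \<open>Con\<close> on
  \<open>Emp\<close>, taken as labels, already give infinitely many variables.\<close>

lemma infinite_variables: "infinite (Collect variable)"
proof -
  have "inj (\<lambda>n. Var ((Con ^^ n) \<^bold>\<emptyset>))"
  proof (rule injI)
    fix m n assume "Var ((Con ^^ m) \<^bold>\<emptyset>) = Var ((Con ^^ n) \<^bold>\<emptyset>)"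
    then have "(Con ^^ m) \<^bold>\<emptyset> = (Con ^^ n) \<^bold>\<emptyset>" by simp
    then show "m = n"
    proof (induction m arbitrary: n)
      case 0 then show ?case by (cases n) auto
    next
      case (Suc m) then show ?case by (cases n) auto
    qed
  qed
  moreover have "object ((Con ^^ n) \<^bold>\<emptyset>)" for n
    by (induction n) (auto intro: object.intros)
  then have "range (\<lambda>n. Var ((Con ^^ n) \<^bold>\<emptyset>)) \<subseteq> Collect variable"
    by (auto simp: variable_def)
  ultimately show ?thesis
    using finite_subset finite_imageD infinite_UNIV_nat by blast
qed

text \<open>Only finitely many variables are excluded at each stage, by the given terms and by those
  already chosen. The list form matches the premise \<open>vars\<close> of the axioms.\<close>

lemma fresh_variables:
  "\<exists>xs. length xs = n \<and> vars xs \<and> (\<forall>x \<in> set xs. \<forall>t \<in> set ts. \<not> appears x t)"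
proof (induction n)
  case 0
  show ?case by (simp add: vars_def)
next
  case (Suc n)
  then obtain xs where xs: "length xs = n" "vars xs"
    "\<forall>x \<in> set xs. \<forall>t \<in> set ts. \<not> appears x t" by blast
  have "finite (set xs \<union> (\<Union>t \<in> set ts. {x. appears x t}))"
    by (simp add: finite_appears)
  then have "\<not> Collect variable \<subseteq> set xs \<union> (\<Union>t \<in> set ts. {x. appears x t})"
    using infinite_variables by (metis finite_subset)
  then obtain x where "variable x" "x \<notin> set xs" "\<forall>t \<in> set ts. \<not> appears x t" by auto
  with xs have "length (x # xs) = Suc n \<and> vars (x # xs)
    \<and> (\<forall>y \<in> set (x # xs). \<forall>t \<in> set ts. \<not> appears y t)"
    by (simp add: vars_def)
  then show ?case by (rule exI)
qed

section \<open>Substitution instances of the axioms\<close>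

lemma subst_not_appears: "\<not> appears x t \<Longrightarrow> t\<^bold>[x \<^bold>:= \<gamma>\<^bold>] = t"
  by (induction t) auto

lemma subst_variable:
  assumes "variable y"
  shows "y\<^bold>[y \<^bold>:= \<gamma>\<^bold>] = \<gamma>" and "x \<noteq> y \<Longrightarrow> y\<^bold>[x \<^bold>:= \<gamma>\<^bold>] = y"
  using assms by (auto simp: variable_def)

text \<open>This iterates R2. The fold treats the head of the list first, so later substitutions
  also act on the objects inserted earlier.\<close>

lemma derivable_inst:
  assumes "\<^bold>\<turnstile> t" "list_all2 (\<lambda>x u. variable x \<and> object u) xs us"
  shows "\<^bold>\<turnstile> fold (\<lambda>(x, u) s. s\<^bold>[x \<^bold>:= u\<^bold>]) (zip xs us) t"
  using assms(2,1)
  by (induction arbitrary: t rule: list_all2_induct) (auto intro: R2)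

text \<open>
  The axioms are stated for distinct variables, and R2 substitutes for one variable at a time;
  variables fresh for all the substituted objects make the successive substitutions independent.
\<close>

lemma axiom_inst1:
  assumes "\<And>a. vars [a] \<Longrightarrow> \<^bold>\<turnstile> f a"
    and "\<And>a x \<gamma>. (f a)\<^bold>[x \<^bold>:= \<gamma>\<^bold>] = f (a\<^bold>[x \<^bold>:= \<gamma>\<^bold>])"
    and "object \<alpha>"
  shows "\<^bold>\<turnstile> f \<alpha>"
proof -
  obtain a where "vars [a]"
    using fresh_variables[of 1 "[]"] by (auto simp: length_Suc_conv)
  \<comment> \<open>Since \<open>f\<close> commutes with substitution, replacing \<open>a\<close> in
    \<open>f a\<close> yields exactly \<open>f\<close> at the new argument.\<close>
  with assms derivable_inst[of "f a" "[a]" "[\<alpha>]"] show ?thesis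
    by (simp add: vars_def subst_variable)
qed

lemma axiom_inst2:
  assumes "\<And>a b. vars [a, b] \<Longrightarrow> \<^bold>\<turnstile> f a b"
    and "\<And>a b x \<gamma>. (f a b)\<^bold>[x \<^bold>:= \<gamma>\<^bold>] = f (a\<^bold>[x \<^bold>:= \<gamma>\<^bold>]) (b\<^bold>[x \<^bold>:= \<gamma>\<^bold>])"
    and "object \<alpha>" "object \<beta>"
  shows "\<^bold>\<turnstile> f \<alpha> \<beta>"
proof -
  \<comment> \<open>\<alpha> is inserted before \<open>b\<close> is replaced, so \<open>b\<close>
    must not appear in it. In general each variable has to avoid the objects inserted before its
    turn.\<close>
  obtain a b where "vars [a, b]" "\<not> appears b \<alpha>"
    using fresh_variables[of 2 "[\<alpha>]"] by (auto simp: length_Suc_conv numeral_2_eq_2)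
  with assms derivable_inst[of "f a b" "[a, b]" "[\<alpha>, \<beta>]"] show ?thesis
    by (simp add: vars_def subst_variable subst_not_appears)
qed

lemma axiom_inst3:
  assumes "\<And>a b c. vars [a, b, c] \<Longrightarrow> \<^bold>\<turnstile> f a b c"
    and "\<And>a b c x \<gamma>. (f a b c)\<^bold>[x \<^bold>:= \<gamma>\<^bold>] = f (a\<^bold>[x \<^bold>:= \<gamma>\<^bold>]) (b\<^bold>[x \<^bold>:= \<gamma>\<^bold>]) (c\<^bold>[x \<^bold>:= \<gamma>\<^bold>])"
    and "object \<alpha>" "object \<beta>" "object \<delta>"
  shows "\<^bold>\<turnstile> f \<alpha> \<beta> \<delta>"
proof -
  obtain a b c where "vars [a, b, c]" "\<not> appears b \<alpha>" "\<not> appears c \<alpha>" "\<not> appears c \<beta>"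
    using fresh_variables[of 3 "[\<alpha>, \<beta>]"] by (auto simp: length_Suc_conv numeral_3_eq_3)
  with assms derivable_inst[of "f a b c" "[a, b, c]" "[\<alpha>, \<beta>, \<delta>]"] show ?thesis
    by (simp add: vars_def subst_variable subst_not_appears)
qed

lemma axiom_inst4:
  assumes "\<And>a b c d. vars [a, b, c, d] \<Longrightarrow> \<^bold>\<turnstile> f a b c d"
    and "\<And>a b c d x \<gamma>. (f a b c d)\<^bold>[x \<^bold>:= \<gamma>\<^bold>]
           = f (a\<^bold>[x \<^bold>:= \<gamma>\<^bold>]) (b\<^bold>[x \<^bold>:= \<gamma>\<^bold>]) (c\<^bold>[x \<^bold>:= \<gamma>\<^bold>]) (d\<^bold>[x \<^bold>:= \<gamma>\<^bold>])"
    and "object \<alpha>" "object \<beta>" "object \<delta>" "object \<epsilon>"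
  shows "\<^bold>\<turnstile> f \<alpha> \<beta> \<delta> \<epsilon>"
proof -
  obtain a b c d where "vars [a, b, c, d]" "\<not> appears b \<alpha>" "\<not> appears c \<alpha>" "\<not> appears c \<beta>"
    "\<not> appears d \<alpha>" "\<not> appears d \<beta>" "\<not> appears d \<delta>"
    using fresh_variables[of 4 "[\<alpha>, \<beta>, \<delta>]"] by (auto simp: length_Suc_conv eval_nat_numeral)
  with assms derivable_inst[of "f a b c d" "[a, b, c, d]" "[\<alpha>, \<beta>, \<delta>, \<epsilon>]"] show ?thesis
    by (simp add: vars_def subst_variable subst_not_appears)
qed

section \<open>Derived rules of inference\<close>

lemma imp_refl: "object \<alpha> \<Longrightarrow> \<^bold>\<turnstile> \<alpha> \<^bold>\<Rightarrow> \<alpha>"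
  by (rule axiom_inst1[of "\<lambda>a. a \<^bold>\<Rightarrow> a"]) (simp_all add: A7)

lemma imp_Emp: "object \<alpha> \<Longrightarrow> \<^bold>\<turnstile> \<alpha> \<^bold>\<Rightarrow> \<^bold>\<emptyset>"
  by (rule axiom_inst1[of "\<lambda>a. a \<^bold>\<Rightarrow> \<^bold>\<emptyset>"]) (simp_all add: A8)

lemma Fed_imp1: "object \<alpha> \<Longrightarrow> object \<beta> \<Longrightarrow> \<^bold>\<turnstile> (\<alpha> \<^bold>& \<beta>) \<^bold>\<Rightarrow> \<alpha>"
  by (rule axiom_inst2[of "\<lambda>a b. (a \<^bold>& b) \<^bold>\<Rightarrow> a"]) (simp_all add: A4a)

lemma Fed_imp2: "object \<alpha> \<Longrightarrow> object \<beta> \<Longrightarrow> \<^bold>\<turnstile> (\<alpha> \<^bold>& \<beta>) \<^bold>\<Rightarrow> \<beta>"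
  by (rule axiom_inst2[of "\<lambda>a b. (a \<^bold>& b) \<^bold>\<Rightarrow> b"]) (simp_all add: A4b)

lemma Imp_imp_Emp_Imp:
  "object \<alpha> \<Longrightarrow> object \<beta> \<Longrightarrow> \<^bold>\<turnstile> (\<alpha> \<^bold>\<Rightarrow> \<beta>) \<^bold>\<Rightarrow> (\<^bold>\<emptyset> \<^bold>\<Rightarrow> (\<alpha> \<^bold>\<Rightarrow> \<beta>))"
  by (rule axiom_inst2[of "\<lambda>a b. (a \<^bold>\<Rightarrow> b) \<^bold>\<Rightarrow> (\<^bold>\<emptyset> \<^bold>\<Rightarrow> (a \<^bold>\<Rightarrow> b))"]) (simp_all add: A11)

text \<open>A11 speaks of formulas only; for them derivability passes to containment of
  \<emptyset>.\<close>

lemma Emp_imp_formula: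
  "\<^bold>\<turnstile> \<alpha> \<^bold>\<Rightarrow> \<beta> \<Longrightarrow> object \<alpha> \<Longrightarrow> object \<beta> \<Longrightarrow> \<^bold>\<turnstile> \<^bold>\<emptyset> \<^bold>\<Rightarrow> (\<alpha> \<^bold>\<Rightarrow> \<beta>)"
  by (rule R1[OF _ Imp_imp_Emp_Imp])

text \<open>The formula \<emptyset> \<Rightarrow> \<emptyset> is itself an object, and A8 applied to
  it lets R1 detach \<emptyset>. An antecedent \<emptyset> can thereby be removed from any derivable
  formula.\<close>

lemma derivable_Emp: "\<^bold>\<turnstile> \<^bold>\<emptyset>"
  by (rule R1[OF imp_refl[of "\<^bold>\<emptyset>"] imp_Emp]) (intro object.intros)+

text \<open>A10 asks for each component with antecedent \<emptyset>; this is where the components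
  being formulas enters, through A11.\<close>

lemma Fed_formulas_intro:
  assumes "\<^bold>\<turnstile> \<alpha> \<^bold>\<Rightarrow> \<beta>" "\<^bold>\<turnstile> \<gamma> \<^bold>\<Rightarrow> \<delta>" "object \<alpha>" "object \<beta>" "object \<gamma>" "object \<delta>"
  shows "\<^bold>\<turnstile> (\<alpha> \<^bold>\<Rightarrow> \<beta>) \<^bold>& (\<gamma> \<^bold>\<Rightarrow> \<delta>)"
proof -
  let ?P = "\<alpha> \<^bold>\<Rightarrow> \<beta>" and ?Q = "\<gamma> \<^bold>\<Rightarrow> \<delta>"
  have "\<^bold>\<turnstile> (\<^bold>\<emptyset> \<^bold>\<Rightarrow> ?P) \<^bold>\<Rightarrow> ((\<^bold>\<emptyset> \<^bold>\<Rightarrow> ?Q) \<^bold>\<Rightarrow> (?P \<^bold>& ?Q))"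
    by (rule axiom_inst2[of "\<lambda>a b. (\<^bold>\<emptyset> \<^bold>\<Rightarrow> a) \<^bold>\<Rightarrow> ((\<^bold>\<emptyset> \<^bold>\<Rightarrow> b) \<^bold>\<Rightarrow> (a \<^bold>& b))"])
      (simp_all add: A10 assms object.intros)
  with Emp_imp_formula have "\<^bold>\<turnstile> (\<^bold>\<emptyset> \<^bold>\<Rightarrow> ?Q) \<^bold>\<Rightarrow> (?P \<^bold>& ?Q)"
    by (rule R1) (fact assms)+
  with Emp_imp_formula show ?thesis
    by (rule R1) (fact assms)+
qed

lemma imp_mp:
  assumes "\<^bold>\<turnstile> \<gamma> \<^bold>\<Rightarrow> \<alpha>" "\<^bold>\<turnstile> \<gamma> \<^bold>\<Rightarrow> (\<alpha> \<^bold>\<Rightarrow> \<beta>)" "object \<gamma>" "object \<alpha>" "object \<beta>"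
  shows "\<^bold>\<turnstile> \<gamma> \<^bold>\<Rightarrow> \<beta>"
proof (rule R1)
  show "\<^bold>\<turnstile> (\<gamma> \<^bold>\<Rightarrow> \<alpha>) \<^bold>& (\<gamma> \<^bold>\<Rightarrow> (\<alpha> \<^bold>\<Rightarrow> \<beta>))"
    using assms by (simp add: Fed_formulas_intro object.intros)
  show "\<^bold>\<turnstile> ((\<gamma> \<^bold>\<Rightarrow> \<alpha>) \<^bold>& (\<gamma> \<^bold>\<Rightarrow> (\<alpha> \<^bold>\<Rightarrow> \<beta>))) \<^bold>\<Rightarrow> (\<gamma> \<^bold>\<Rightarrow> \<beta>)"
    by (rule axiom_inst3[of "\<lambda>a b c. ((c \<^bold>\<Rightarrow> a) \<^bold>& (c \<^bold>\<Rightarrow> (a \<^bold>\<Rightarrow> b))) \<^bold>\<Rightarrow> (c \<^bold>\<Rightarrow> b)"])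
      (simp_all add: A1 assms)
qed

lemma imp_trans_under:
  assumes "\<^bold>\<turnstile> \<gamma> \<^bold>\<Rightarrow> (\<alpha> \<^bold>\<Rightarrow> \<beta>)" "\<^bold>\<turnstile> \<gamma> \<^bold>\<Rightarrow> (\<beta> \<^bold>\<Rightarrow> \<delta>)"
    "object \<gamma>" "object \<alpha>" "object \<beta>" "object \<delta>"
  shows "\<^bold>\<turnstile> \<gamma> \<^bold>\<Rightarrow> (\<alpha> \<^bold>\<Rightarrow> \<delta>)"
proof (rule R1)
  show "\<^bold>\<turnstile> (\<gamma> \<^bold>\<Rightarrow> (\<alpha> \<^bold>\<Rightarrow> \<beta>)) \<^bold>& (\<gamma> \<^bold>\<Rightarrow> (\<beta> \<^bold>\<Rightarrow> \<delta>))"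
    using assms by (simp add: Fed_formulas_intro object.intros)
  show "\<^bold>\<turnstile> ((\<gamma> \<^bold>\<Rightarrow> (\<alpha> \<^bold>\<Rightarrow> \<beta>)) \<^bold>& (\<gamma> \<^bold>\<Rightarrow> (\<beta> \<^bold>\<Rightarrow> \<delta>))) \<^bold>\<Rightarrow> (\<gamma> \<^bold>\<Rightarrow> (\<alpha> \<^bold>\<Rightarrow> \<delta>))"
    by (rule axiom_inst4[of
          "\<lambda>a b c d. ((d \<^bold>\<Rightarrow> (a \<^bold>\<Rightarrow> b)) \<^bold>& (d \<^bold>\<Rightarrow> (b \<^bold>\<Rightarrow> c))) \<^bold>\<Rightarrow> (d \<^bold>\<Rightarrow> (a \<^bold>\<Rightarrow> c))"])
      (simp_all add: A2 assms)
qed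

lemma imp_Fed_under:
  assumes "object \<gamma>" "object \<alpha>" "object \<beta>"
  shows "\<^bold>\<turnstile> ((\<gamma> \<^bold>\<Rightarrow> \<alpha>) \<^bold>& (\<gamma> \<^bold>\<Rightarrow> \<beta>)) \<^bold>\<Rightarrow> (\<gamma> \<^bold>\<Rightarrow> (\<alpha> \<^bold>& \<beta>))"
  by (rule axiom_inst3[of "\<lambda>a b c. ((c \<^bold>\<Rightarrow> a) \<^bold>& (c \<^bold>\<Rightarrow> b)) \<^bold>\<Rightarrow> (c \<^bold>\<Rightarrow> (a \<^bold>& b))"])
    (simp_all add: A3 assms)

lemma imp_Fed_intro:
  assumes "\<^bold>\<turnstile> \<gamma> \<^bold>\<Rightarrow> \<alpha>" "\<^bold>\<turnstile> \<gamma> \<^bold>\<Rightarrow> \<beta>" "object \<gamma>" "object \<alpha>" "object \<beta>"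
  shows "\<^bold>\<turnstile> \<gamma> \<^bold>\<Rightarrow> (\<alpha> \<^bold>& \<beta>)"
  by (rule R1[OF Fed_formulas_intro imp_Fed_under]) (simp_all add: assms)

text \<open>A2 gives transitivity under a common antecedent. Taking \<emptyset> for it, the
  antecedent can be added by A11 and afterwards detached.\<close>

lemma imp_trans:
  assumes "\<^bold>\<turnstile> \<alpha> \<^bold>\<Rightarrow> \<beta>" "\<^bold>\<turnstile> \<beta> \<^bold>\<Rightarrow> \<gamma>" "object \<alpha>" "object \<beta>" "object \<gamma>"
  shows "\<^bold>\<turnstile> \<alpha> \<^bold>\<Rightarrow> \<gamma>"
proof (rule R1[OF derivable_Emp])
  show "\<^bold>\<turnstile> \<^bold>\<emptyset> \<^bold>\<Rightarrow> (\<alpha> \<^bold>\<Rightarrow> \<gamma>)"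
    by (rule imp_trans_under[of _ \<alpha> \<beta> \<gamma>]) (simp_all add: assms Emp_imp_formula object.intros)
qed

lemma imp_weaken:
  assumes "\<^bold>\<turnstile> \<alpha> \<^bold>\<Rightarrow> \<beta>" "object \<gamma>" "object \<alpha>" "object \<beta>"
  shows "\<^bold>\<turnstile> \<gamma> \<^bold>\<Rightarrow> (\<alpha> \<^bold>\<Rightarrow> \<beta>)"
  by (rule imp_trans[of _ "\<^bold>\<emptyset>"]) (simp_all add: imp_Emp Emp_imp_formula assms object.intros)

text \<open>Under the federation each component is contained in by \<emptyset> separately, and A3,
  read with antecedent \<emptyset>, joins the two. Federations of formulas therefore inherit the
  property that A11 gives to formulas.\<close>

lemma imp_Emp_Fed:
  assumes "\<^bold>\<turnstile> \<alpha> \<^bold>\<Rightarrow> (\<^bold>\<emptyset> \<^bold>\<Rightarrow> \<alpha>)" "\<^bold>\<turnstile> \<beta> \<^bold>\<Rightarrow> (\<^bold>\<emptyset> \<^bold>\<Rightarrow> \<beta>)" "object \<alpha>" "object \<beta>"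
  shows "\<^bold>\<turnstile> (\<alpha> \<^bold>& \<beta>) \<^bold>\<Rightarrow> (\<^bold>\<emptyset> \<^bold>\<Rightarrow> (\<alpha> \<^bold>& \<beta>))"
proof -
  note [intro] = assms object.intros
  have "\<^bold>\<turnstile> (\<alpha> \<^bold>& \<beta>) \<^bold>\<Rightarrow> (\<^bold>\<emptyset> \<^bold>\<Rightarrow> \<alpha>)" by (rule imp_trans[OF Fed_imp1]) auto
  moreover have "\<^bold>\<turnstile> (\<alpha> \<^bold>& \<beta>) \<^bold>\<Rightarrow> (\<^bold>\<emptyset> \<^bold>\<Rightarrow> \<beta>)" by (rule imp_trans[OF Fed_imp2]) auto
  ultimately have "\<^bold>\<turnstile> (\<alpha> \<^bold>& \<beta>) \<^bold>\<Rightarrow> ((\<^bold>\<emptyset> \<^bold>\<Rightarrow> \<alpha>) \<^bold>& (\<^bold>\<emptyset> \<^bold>\<Rightarrow> \<beta>))"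
    by (rule imp_Fed_intro) auto
  then show ?thesis by (rule imp_trans[OF _ imp_Fed_under]) auto
qed

text \<open>The first premise supplies the weakening \<alpha> \<Rightarrow> (\<beta> \<Rightarrow>
  \<alpha>): under \<alpha>, the object \<beta> implies \<emptyset> by A8, and \<emptyset> implies
  \<alpha>. This serves as a deduction theorem for discharging the hypothesis \<beta>.\<close>

lemma Fed_imp_curry:
  assumes "\<^bold>\<turnstile> \<alpha> \<^bold>\<Rightarrow> (\<^bold>\<emptyset> \<^bold>\<Rightarrow> \<alpha>)" "\<^bold>\<turnstile> (\<alpha> \<^bold>& \<beta>) \<^bold>\<Rightarrow> \<gamma>"
    and obj: "object \<alpha>" "object \<beta>" "object \<gamma>"
  shows "\<^bold>\<turnstile> \<alpha> \<^bold>\<Rightarrow> (\<beta> \<^bold>\<Rightarrow> \<gamma>)"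
proof -
  note [intro] = obj object.intros
  have "\<^bold>\<turnstile> \<alpha> \<^bold>\<Rightarrow> (\<beta> \<^bold>\<Rightarrow> \<^bold>\<emptyset>)" by (intro imp_weaken imp_Emp) auto
  then have "\<^bold>\<turnstile> \<alpha> \<^bold>\<Rightarrow> (\<beta> \<^bold>\<Rightarrow> \<alpha>)" by (rule imp_trans_under[OF _ assms(1)]) auto
  moreover have "\<^bold>\<turnstile> \<alpha> \<^bold>\<Rightarrow> (\<beta> \<^bold>\<Rightarrow> \<beta>)" by (intro imp_weaken imp_refl) auto
  ultimately have "\<^bold>\<turnstile> \<alpha> \<^bold>\<Rightarrow> ((\<beta> \<^bold>\<Rightarrow> \<alpha>) \<^bold>& (\<beta> \<^bold>\<Rightarrow> \<beta>))" by (rule imp_Fed_intro) auto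
  then have "\<^bold>\<turnstile> \<alpha> \<^bold>\<Rightarrow> (\<beta> \<^bold>\<Rightarrow> (\<alpha> \<^bold>& \<beta>))" by (rule imp_trans[OF _ imp_Fed_under]) auto
  moreover have "\<^bold>\<turnstile> \<alpha> \<^bold>\<Rightarrow> ((\<alpha> \<^bold>& \<beta>) \<^bold>\<Rightarrow> \<gamma>)" by (rule imp_weaken[OF assms(2)]) auto
  ultimately show ?thesis by (rule imp_trans_under) auto
qed

text \<open>Both containments pass through \<emptyset>. Everything implies \<emptyset> by A8; under
  \<gamma>, \<emptyset> implies \<alpha> by assumption, and it implies \<open>Bar\<close> \<alpha>
  by A11, because \<open>Bar\<close> \<alpha> is a formula whatever \<alpha> is.\<close>

lemma imp_Bar_Eq:
  assumes "\<^bold>\<turnstile> \<gamma> \<^bold>\<Rightarrow> Bar \<alpha>" and obj: "object \<gamma>" "object \<alpha>"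
  shows "\<^bold>\<turnstile> \<gamma> \<^bold>\<Rightarrow> (Bar \<alpha> \<^bold>= \<alpha>)"
proof -
  note [intro] = obj object.intros
  have bar: "\<^bold>\<turnstile> \<gamma> \<^bold>\<Rightarrow> (\<^bold>\<emptyset> \<^bold>\<Rightarrow> \<alpha>)" using assms(1) by (simp add: Bar_def)
  have "\<^bold>\<turnstile> \<gamma> \<^bold>\<Rightarrow> ((\<^bold>\<emptyset> \<^bold>\<Rightarrow> \<alpha>) \<^bold>\<Rightarrow> \<^bold>\<emptyset>)" by (intro imp_weaken imp_Emp) auto
  then have l: "\<^bold>\<turnstile> \<gamma> \<^bold>\<Rightarrow> ((\<^bold>\<emptyset> \<^bold>\<Rightarrow> \<alpha>) \<^bold>\<Rightarrow> \<alpha>)" by (rule imp_trans_under[OF _ bar]) auto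
  have "\<^bold>\<turnstile> \<gamma> \<^bold>\<Rightarrow> (\<alpha> \<^bold>\<Rightarrow> \<^bold>\<emptyset>)" by (intro imp_weaken imp_Emp) auto
  moreover have "\<^bold>\<turnstile> \<gamma> \<^bold>\<Rightarrow> (\<^bold>\<emptyset> \<^bold>\<Rightarrow> (\<^bold>\<emptyset> \<^bold>\<Rightarrow> \<alpha>))"
    by (rule imp_trans[OF bar Imp_imp_Emp_Imp]) auto
  ultimately have "\<^bold>\<turnstile> \<gamma> \<^bold>\<Rightarrow> (\<alpha> \<^bold>\<Rightarrow> (\<^bold>\<emptyset> \<^bold>\<Rightarrow> \<alpha>))" by (rule imp_trans_under) auto
  with l show ?thesis
    unfolding Eq_def Bar_def by (intro imp_Fed_intro) auto
qed

section \<open>Members exclude equality with \<emptyset>\<close>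

lemma object_Bot: "object \<^bold>\<bottom>"
  by (simp add: Bot_def object.intros)

lemma Mem_imp_Neq_Emp:
  assumes obj: "object \<alpha>" "object \<beta>" "object \<gamma>"
  shows "\<^bold>\<turnstile> (\<alpha> \<^bold>\<in>\<^bold>[\<beta>\<^bold>] \<gamma>) \<^bold>\<Rightarrow> (\<^bold>\<emptyset> \<^bold>\<noteq> \<gamma>)"
proof -
  let ?S1 = "Bar \<alpha> \<^bold>\<noteq> \<alpha>"
  let ?S2 = "(\<alpha> \<^bold>\<Rightarrow> \<beta>) \<^bold>\<Rightarrow> (Bar \<beta> \<^bold>\<or> (\<alpha> \<^bold>= \<beta>))"
  let ?H = "\<alpha> \<^bold>\<in>\<^bold>[\<beta>\<^bold>] \<gamma>"
  let ?E = "\<^bold>\<emptyset> \<^bold>= \<gamma>"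
  \<comment> \<open>Both hypotheses are federated into one antecedent, under which \<bottom> is
    derived before \<open>?E\<close> is split off again.\<close>
  let ?G = "?H \<^bold>& ?E"
  have o: "object ?S1" "object ?S2" "object ?E" "object ?H" "object ?G"
    "object (Bar \<alpha> \<^bold>= \<alpha>)" "object (Sing \<beta> \<alpha>)" "object (\<^bold>\<emptyset> \<^bold>\<Rightarrow> \<gamma>)"
    "object (\<gamma> \<^bold>\<Rightarrow> \<alpha>)" "object (\<gamma> \<^bold>\<Rightarrow> \<^bold>\<emptyset>)" "object (\<alpha> \<^bold>\<Rightarrow> \<beta>)" "object (Bar \<beta> \<^bold>\<or> (\<alpha> \<^bold>= \<beta>))"
    by (simp_all add: Bar_def Neg_def Neq_def Or_def Eq_def Sing_def Mem_def
        obj object.intros object_Bot)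
  have H: "\<^bold>\<turnstile> ?G \<^bold>\<Rightarrow> ?H" by (rule Fed_imp1) (fact o)+
  have E: "\<^bold>\<turnstile> ?G \<^bold>\<Rightarrow> ?E" by (rule Fed_imp2) (fact o)+
  have "\<^bold>\<turnstile> ?H \<^bold>\<Rightarrow> Sing \<beta> \<alpha>" unfolding Mem_def by (rule Fed_imp1) (fact o)+
  moreover have "\<^bold>\<turnstile> Sing \<beta> \<alpha> \<^bold>\<Rightarrow> ?S1" unfolding Sing_def by (rule Fed_imp1) (fact o)+
  ultimately have "\<^bold>\<turnstile> ?H \<^bold>\<Rightarrow> ?S1" by (rule imp_trans) (fact o)+
  with H have S: "\<^bold>\<turnstile> ?G \<^bold>\<Rightarrow> ?S1" by (rule imp_trans) (fact o)+
  have "\<^bold>\<turnstile> ?E \<^bold>\<Rightarrow> (\<^bold>\<emptyset> \<^bold>\<Rightarrow> \<gamma>)" unfolding Eq_def by (rule Fed_imp1) (fact o)+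
  with E have "\<^bold>\<turnstile> ?G \<^bold>\<Rightarrow> (\<^bold>\<emptyset> \<^bold>\<Rightarrow> \<gamma>)" by (rule imp_trans) (fact o)+
  moreover have "\<^bold>\<turnstile> ?H \<^bold>\<Rightarrow> (\<gamma> \<^bold>\<Rightarrow> \<alpha>)" unfolding Mem_def by (rule Fed_imp2) (fact o)+
  with H have "\<^bold>\<turnstile> ?G \<^bold>\<Rightarrow> (\<gamma> \<^bold>\<Rightarrow> \<alpha>)" by (rule imp_trans) (fact o)+
  ultimately have "\<^bold>\<turnstile> ?G \<^bold>\<Rightarrow> Bar \<alpha>"
    unfolding Bar_def by (rule imp_trans_under) (fact o object.intros(1) obj)+
  then have "\<^bold>\<turnstile> ?G \<^bold>\<Rightarrow> (Bar \<alpha> \<^bold>= \<alpha>)" by (rule imp_Bar_Eq) (fact o obj)+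
  \<comment> \<open>Unfolded, \<open>?S1\<close> is (\<open>Bar\<close> \<alpha> = \<alpha>)
    \<Rightarrow> \<bottom>, so modus ponens under \<open>?G\<close> applies.\<close>
  then have bot: "\<^bold>\<turnstile> ?G \<^bold>\<Rightarrow> \<^bold>\<bottom>"
    using S unfolding Neq_def Neg_def by (rule imp_mp) (fact o object_Bot)+
  \<comment> \<open>\<open>?H\<close> is a nested federation of three formulas: the inequation and
    the implication in \<open>Sing\<close>, and \<gamma> \<Rightarrow> \<alpha>. A11 handles each of
    them.\<close>
  have "\<^bold>\<turnstile> ?H \<^bold>\<Rightarrow> (\<^bold>\<emptyset> \<^bold>\<Rightarrow> ?H)"
    unfolding Mem_def Sing_def Neq_def Neg_def
    by (intro imp_Emp_Fed Imp_imp_Emp_Imp)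
      (fact o[unfolded Sing_def Neq_def Neg_def] obj object_Bot)+
  \<comment> \<open>The conclusion is by definition \<open>?E\<close> \<Rightarrow> \<bottom>, so it
    results from currying. Only the outer inequation is unfolded, leaving the one inside
    \<open>?H\<close> intact.\<close>
  from this bot show ?thesis
    unfolding Neq_def[of "\<^bold>\<emptyset>"] Neg_def[of ?E] by (rule Fed_imp_curry) (fact o object_Bot)+
qed

theorem theorem3p21:
  fixes \<phi> x a b :: tm
  assumes "formula \<phi>" and "variable x" and "variable a"
    and "variable b" and "b \<noteq> a"
  shows "\<^bold>\<turnstile> (a \<^bold>\<in>\<^bold>[b\<^bold>] \<^bold>{x \<^bold>| \<phi>\<^bold>}) \<^bold>\<Rightarrow> (\<^bold>\<exists>x\<^bold>. \<phi>)"
proof -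
  have "object \<^bold>{x \<^bold>| \<phi>\<^bold>}"
    using assms(1,2) by (auto simp: formula_def variable_def intro!: object.intros)
  then show ?thesis
    unfolding Exists_def using assms by (simp add: Mem_imp_Neq_Emp variable_object)
qed

end
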